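(* Consider a normalized Hamburger moment problem with orthonormal polynomials $P_n$, polynomials of the second kind $Q_n$ and recurrence coefficients $a_n\in\mathbb R$, $b_n>0$. Assume that $$\sum_{n=1}^\infty\frac{1+|a_n|}{\sqrt{b_nb_{n-1}}}<\infty,$$ and that there is $n_0\ge1$ such that either $b_n^2\le b_{n-1}b_{n+1}$ for all $n\ge n_0$, or $b_n^2\ge b_{n-1}b_{n+1}$ for all $n\ge n_0$. Assume in addition that the function $P$ has order bounded by some given order function $\alpha$, with dual function $\beta$. (i) If there is $\gamma$ with $0<\gamma<1$ such that $r^\gamma\le\alpha(r)$ for all sufficiently large $r$, then, as $n\to\infty$, $$\beta(1/b_n),\ \beta(P_n^2(0)),\ \beta(Q_n^2(0))=O\Big(\frac{\log n}{n}\Big).$$ (ii) If $\alpha(r^2)=O(\alpha(r))$ as $r\to\infty$, then, as $n\to\infty$, $$\beta(1/b_n),\ \beta(P_n^2(0)),\ \beta(Q_n^2(0))=O(1/n).$$ In both cases $\beta(1/b_n),\beta(P_n^2(0)),\beta(Q_n^2(0))\in\ell^{1+\varepsilon}$ for any $\varepsilon>0$.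
   Context: An order function is a continuous, positive and increasing function $\alpha:(r_0,\infty)\to\mathbb R$, where $0\le r_0<\infty$, with $\lim_{r\to\infty}\alpha(r)=\infty$ and such that $r/\alpha(r)$ is also increasing with $\lim_{r\to\infty}r/\alpha(r)=\infty$. Its dual function is $\beta(r)=1/\alpha(r^{-1})$ for $0<r<r_0^{-1}$ (with $0^{-1}=\infty$), and $\beta(0)=0$. For a sequence $u_n\ge0$ tending to zero, $\beta(u_n)$ is defined only for sufficiently large $n$; $\beta(u_n)\in\ell^{p}$ means $\sum_{n\ge N}\beta(u_n)^p<\infty$ for $N$ sufficiently large. A continuous unbounded $f:\mathbb C\to\mathbb C$ has order bounded by $\alpha$ if there is a constant $K$ with $M_f(r)\le r^{K\alpha(r)}$ for all sufficiently large $r$, where $M_f(r)=\max_{|z|\le r}|f(z)|$. A normalized Hamburger moment problem is given by a sequence $s_n=\int_{-\infty}^\infty x^n\,d\mu(x)$, $n\ge0$, where $\mu$ is a probability measure on $\mathbb R$ with infinite support and moments of every order. The orthonormal polynomials $P_n$ and polynomials of the second kind $Q_n$ are solutions of $$z r_n(z)=b_nr_{n+1}(z)+a_nr_n(z)+b_{n-1}r_{n-1}(z),\quad n\ge0,$$ with $a_n\in\mathbb R$, $b_n>0$ for $n\ge0$, $b_{-1}=1$, and initial conditions $P_0=1$, $P_{-1}=0$, $Q_0=0$, $Q_{-1}=-1$. Put $P(z)=(\sum_{n\ge0}|P_n(z)|^2)^{1/2}$; under the summability and log-convexity/log-concavity hypotheses of the claim the problem is known to be indeterminate and $P$ is finite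 and continuous on $\mathbb C$. *)

theory Defs
  imports "HOL-Probability.Probability" "HOL-Library.Landau_Symbols"
    "HOL-Computational_Algebra.Polynomial"
begin

definition measure_support :: "real measure \<Rightarrow> real set" where
  "measure_support \<mu> = {x. \<forall>\<epsilon>>0. measure \<mu> (ball x \<epsilon>) > 0}"

definition normalized_hamburger :: "real measure \<Rightarrow> bool" where
  "normalized_hamburger \<mu> \<longleftrightarrow>
     prob_space \<mu> \<and> sets \<mu> = sets borel \<and> infinite (measure_support \<mu>) \<and>
     (\<forall>n. integrable \<mu> (\<lambda>x. x ^ n))"

definition orthonormal_polys :: "real measure \<Rightarrow> (nat \<Rightarrow> real poly) \<Rightarrow> bool" where
  "orthonormal_polys \<mu> p \<longleftrightarrow>
     (\<forall>n. degree (p n) = n \<and> lead_coeff (p n) > 0) \<and>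
     (\<forall>m n. (LINT x|\<mu>. poly (p m) x * poly (p n) x) = (if m = n then 1 else 0))"

text \<open>
  The recurrence \<open>z r\<^sub>n = b\<^sub>n r\<^sub>n\<^sub>+\<^sub>1 + a\<^sub>n r\<^sub>n + b\<^sub>n\<^sub>-\<^sub>1 r\<^sub>n\<^sub>-\<^sub>1\<close> for \<open>n \<ge> 0\<close>, as an identity
  between polynomials in \<open>z\<close>. The argument \<open>c\<close> is the initial value at index \<open>-1\<close>; the equation
  for \<open>n = 0\<close> is separate and uses the convention that \<open>b\<close> has the value 1 at index \<open>-1\<close>.
\<close>

definition solves_recurrence ::
  "(nat \<Rightarrow> real) \<Rightarrow> (nat \<Rightarrow> real) \<Rightarrow> real \<Rightarrow> (nat \<Rightarrow> real poly) \<Rightarrow> bool" where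
  "solves_recurrence a b c r \<longleftrightarrow>
     [:0, 1:] * r 0 = smult (b 0) (r 1) + smult (a 0) (r 0) + [:c:] \<and>
     (\<forall>n\<ge>1. [:0, 1:] * r n =
        smult (b n) (r (n + 1)) + smult (a n) (r n) + smult (b (n - 1)) (r (n - 1)))"

text \<open>
  The measure determines all of \<open>p\<close> (orthonormal polynomials), \<open>q\<close> (polynomials of the second kind),
  \<open>a\<close> and \<open>b\<close> (recurrence coefficients).
\<close>

definition hamburger_data :: "real measure \<Rightarrow> (nat \<Rightarrow> real poly) \<Rightarrow> (nat \<Rightarrow> real poly) \<Rightarrow>
    (nat \<Rightarrow> real) \<Rightarrow> (nat \<Rightarrow> real) \<Rightarrow> bool" where
  "hamburger_data \<mu> p q a b \<longleftrightarrow>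
     normalized_hamburger \<mu> \<and> orthonormal_polys \<mu> p \<and> (\<forall>n. b n > 0) \<and>
     p 0 = 1 \<and> solves_recurrence a b 0 p \<and>
     q 0 = 0 \<and> solves_recurrence a b (- 1) q"

text \<open>
  The function \<open>P(z)\<close>. The series is not assumed to converge; its convergence, locally uniform in
  \<open>z\<close>, is a consequence of the summability and log-convexity or log-concavity hypotheses under which
  the function is used.
\<close>

definition P_fun :: "(nat \<Rightarrow> real poly) \<Rightarrow> complex \<Rightarrow> real" where
  "P_fun p z = sqrt (\<Sum>n. (cmod (poly (map_poly complex_of_real (p n)) z))\<^sup>2)"

text \<open>Monotonicity is in the weak sense, both for \<open>\<alpha>\<close> and for \<open>r / \<alpha> r\<close>.\<close>

definition order_function :: "real \<Rightarrow> (real \<Rightarrow> real) \<Rightarrow> bool" where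
  "order_function r0 \<alpha> \<longleftrightarrow>
     0 \<le> r0 \<and> continuous_on {r0<..} \<alpha> \<and> (\<forall>r>r0. \<alpha> r > 0) \<and>
     mono_on {r0<..} \<alpha> \<and> filterlim \<alpha> at_top at_top \<and>
     mono_on {r0<..} (\<lambda>r. r / \<alpha> r) \<and> filterlim (\<lambda>r. r / \<alpha> r) at_top at_top"

text \<open>Only the values at \<open>0\<close> and at \<open>r > 0\<close> with \<open>r0 * r < 1\<close> are meaningful.\<close>

definition dual_fun :: "(real \<Rightarrow> real) \<Rightarrow> real \<Rightarrow> real" where
  "dual_fun \<alpha> r = (if r = 0 then 0 else 1 / \<alpha> (inverse r))"

definition max_modulus :: "(complex \<Rightarrow> 'a::real_normed_vector) \<Rightarrow> real \<Rightarrow> real" where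
  "max_modulus f r = (SUP z\<in>cball 0 r. norm (f z))"

definition order_bounded_by ::
  "(complex \<Rightarrow> 'a::real_normed_vector) \<Rightarrow> (real \<Rightarrow> real) \<Rightarrow> bool" where
  "order_bounded_by f \<alpha> \<longleftrightarrow>
     (\<exists>K::real. \<forall>\<^sub>F r in at_top. max_modulus f r \<le> r powr (K * \<alpha> r))"

text \<open>
  For a dual function \<open>\<beta>\<close>, statements about \<open>\<beta>(u\<^sub>n)\<close> presuppose that \<open>u\<close> is a nonnegative null
  sequence, so that \<open>u\<^sub>n\<close> eventually lies in the domain of \<open>\<beta>\<close>; the presupposition is part of both
  predicates below.
\<close>

definition dual_bigo :: "(real \<Rightarrow> real) \<Rightarrow> (nat \<Rightarrow> real) \<Rightarrow> (nat \<Rightarrow> real) \<Rightarrow> bool" where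
  "dual_bigo \<beta> u g \<longleftrightarrow>
     (\<forall>n. 0 \<le> u n) \<and> u \<longlonglongrightarrow> 0 \<and> (\<lambda>n. \<beta> (u n)) \<in> O(g)"

definition dual_in_ell :: "(real \<Rightarrow> real) \<Rightarrow> (nat \<Rightarrow> real) \<Rightarrow> real \<Rightarrow> bool" where
  "dual_in_ell \<beta> u e \<longleftrightarrow>
     (\<forall>n. 0 \<le> u n) \<and> u \<longlonglongrightarrow> 0 \<and>
     (\<forall>\<^sub>F N in sequentially. summable (\<lambda>n. \<beta> (u (N + n)) powr e))"

end

theory Submission
  imports Defs "HOL-Complex_Analysis.Cauchy_Integral_Formula" "HOL-Real_Asymp.Real_Asymp"
begin

text \<open>
  Log-convexity or log-concavity turns the recurrence into a three-term inequality for the sequence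
  \<open>\<surd>w\<^sub>n |r\<^sub>n\<^sub>+\<^sub>1(z)|\<close>, with \<open>w\<^sub>n\<close> either \<open>b\<^sub>n\<close> or \<open>b\<^sub>n\<^sub>+\<^sub>1\<close>, which stays bounded locally uniformly in \<open>z\<close>
  by summability. So \<open>|r\<^sub>n\<^sub>+\<^sub>1(z)|\<^sup>2 = O(1 / b\<^sub>n)\<close>, \<open>P\<close> is locally bounded, and all three claims reduce to
  the one on \<open>1 / b\<^sub>n\<close>. There the Cauchy estimate for the leading coefficient
  \<open>1 / (b\<^sub>0 \<cdots> b\<^sub>n\<^sub>-\<^sub>1)\<close> of \<open>P\<^sub>n\<close> gives \<open>r\<^sup>n \<le> b\<^sub>0 \<cdots> b\<^sub>n\<^sub>-\<^sub>1 M\<^sub>P(r) \<le> b\<^sub>n\<^sup>n r\<^bsup>K \<alpha>(r)\<^esup>\<close>, since \<open>b\<close> eventually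
  increases; one takes \<open>r = b\<^sub>n\<^sup>2\<close> if \<open>\<alpha>(r\<^sup>2) = O(\<alpha>(r))\<close>, and \<open>r = e b\<^sub>n\<close> if \<open>r\<^sup>\<gamma> \<le> \<alpha>(r)\<close>.
\<close>

section \<open>Cauchy estimate for the leading coefficient\<close>

text \<open>The reflected polynomial takes the value \<open>lead_coeff f\<close> at 0, so this is
  the Cauchy inequality of order zero for it on the circle of radius \<open>1 / r\<close>.\<close>

lemma lead_coeff_le_of_norm_le_on_sphere:
  fixes f :: "complex poly"
  assumes "r > 0" and B: "\<And>z. cmod z = r \<Longrightarrow> cmod (poly f z) \<le> B"
  shows "cmod (lead_coeff f) * r ^ degree f \<le> B"
proof -
  have hol: "poly (reflect_poly f) holomorphic_on A" for A
    unfolding holomorphic_on_def field_differentiable_def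
    by (blast intro: has_field_derivative_at_within poly_DERIV)
  have "cmod ((deriv ^^ 0) (poly (reflect_poly f)) 0) \<le> fact 0 * (B / r ^ degree f) / (1 / r) ^ 0"
  proof (rule Cauchy_inequality)
    show "continuous_on (cball 0 (1 / r)) (poly (reflect_poly f))"
      by (intro holomorphic_on_imp_continuous_on hol)
    show "cmod (poly (reflect_poly f) w) \<le> B / r ^ degree f" if "cmod (0 - w) = 1 / r" for w
    proof -
      have "w \<noteq> 0" and w: "cmod w = 1 / r"
        using that \<open>r > 0\<close> by auto
      have "cmod (poly (reflect_poly f) w) = cmod (poly f (inverse w)) / r ^ degree f"
        using \<open>w \<noteq> 0\<close> w by (simp add: poly_reflect_poly_nz norm_mult norm_power power_divide)
      also have "\<dots> \<le> B / r ^ degree f"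
        using w \<open>r > 0\<close> by (intro divide_right_mono B) (auto simp: norm_inverse)
      finally show ?thesis .
    qed
  qed (use \<open>r > 0\<close> hol in auto)
  then show ?thesis
    using \<open>r > 0\<close> by (simp add: field_simps)
qed

section \<open>Evaluation and leading coefficients of solutions of the recurrence\<close>

lemma poly_map_poly_of_real_simps:
  fixes f g :: "real poly" and z :: complex
  shows "poly (map_poly of_real (f + g)) z = poly (map_poly of_real f) z + poly (map_poly of_real g) z"
    and "poly (map_poly of_real (smult c f)) z = of_real c * poly (map_poly of_real f) z"
    and "poly (map_poly of_real (pCons c f)) z = of_real c + z * poly (map_poly of_real f) z"
    and "poly (map_poly of_real f) 0 = of_real (poly f 0)"
proof -
  have "map_poly of_real (f + g) = map_poly of_real f + (map_poly of_real g :: complex poly)"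
    by (intro poly_eqI) (simp add: coeff_map_poly)
  then show "poly (map_poly of_real (f + g)) z = poly (map_poly of_real f) z + poly (map_poly of_real g) z"
    by simp
qed (simp_all add: map_poly_smult map_poly_pCons poly_0_coeff_0 coeff_map_poly)

lemma solves_recurrence_eval:
  assumes "solves_recurrence a b c r" and "n \<ge> 1"
  shows "z * poly (map_poly complex_of_real (r n)) z =
    b n * poly (map_poly of_real (r (n + 1))) z + a n * poly (map_poly of_real (r n)) z
      + b (n - 1) * poly (map_poly of_real (r (n - 1))) z"
proof -
  have "pCons 0 (r n) = smult (b n) (r (n + 1)) + smult (a n) (r n) + smult (b (n - 1)) (r (n - 1))"
    using assms by (simp add: solves_recurrence_def)
  then show ?thesis
    by (metis poly_map_poly_of_real_simps(1-3) of_real_0 add_0)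
qed

text \<open>In degree \<open>n + 1\<close> only the term with \<open>r (n + 1)\<close> survives on
  the right of the recurrence, so each step divides the leading coefficient by
  \<open>b n\<close>.\<close>

lemma solves_recurrence_coeff:
  assumes rec: "solves_recurrence a b 0 r" and deg: "\<And>n. degree (r n) = n" and "r 0 = 1"
  shows "coeff (r n) n * (\<Prod>k<n. b k) = 1"
proof (induction n)
  case 0
  then show ?case using \<open>r 0 = 1\<close> by simp
next
  case (Suc n)
  \<comment> \<open>The value 0 at index -1 lets both clauses of the recurrence be read as one
    equation.\<close>
  have "pCons 0 (r n) = smult (b n) (r (Suc n)) + smult (a n) (r n)
      + (if n = 0 then 0 else smult (b (n - 1)) (r (n - 1)))"
    using rec by (cases n) (auto simp: solves_recurrence_def)
  then have "coeff (pCons 0 (r n)) (Suc n) = coeff (smult (b n) (r (Suc n)) + smult (a n) (r n)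
      + (if n = 0 then 0 else smult (b (n - 1)) (r (n - 1)))) (Suc n)"
    by simp
  moreover have "coeff (r n) (Suc n) = 0" "n > 0 \<Longrightarrow> coeff (r (n - 1)) (Suc n) = 0"
    by (auto intro!: coeff_eq_0 simp: deg)
  ultimately have "coeff (r n) n = b n * coeff (r (Suc n)) (Suc n)"
    by (auto split: if_splits)
  with Suc show ?case
    by (simp add: mult_ac)
qed

section \<open>A discrete Gronwall inequality\<close>

text \<open>Since \<open>1 + t n \<le> exp (t n)\<close>, the majorant \<open>E\<close> grows in
  each step by at least the factor \<open>1 + t n\<close>. As \<open>E\<close> increases,
  \<open>E n\<close> can bound \<open>v n\<close> and \<open>v (n + 1)\<close> together, and
  summability of \<open>t\<close> keeps \<open>E\<close> bounded.\<close>

lemma three_term_inequality_bounded: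
  fixes v t :: "nat \<Rightarrow> real"
  assumes "summable t" and t: "\<And>n. t n \<ge> 0"
    and v: "\<And>n. n \<ge> N \<Longrightarrow> v (n + 2) \<le> t n * v (n + 1) + v n"
    and "v N \<le> K" "v (N + 1) \<le> K" "0 \<le> K" "n \<ge> N"
  shows "v n \<le> K * exp (suminf t)"
proof -
  define E where "E n = K * exp (sum t {..<n})" for n
  have E_step: "E n \<le> E (n + 1)" "(1 + t n) * E n \<le> E (n + 1)" "0 \<le> E n" for n
  proof -
    show nonneg: "0 \<le> E n" using \<open>0 \<le> K\<close> by (simp add: E_def)
    have "(1 + t n) * E n \<le> exp (t n) * E n"
      using nonneg by (intro mult_right_mono) auto
    then show "(1 + t n) * E n \<le> E (n + 1)"
      by (simp add: E_def exp_add mult_ac)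
    with t[of n] nonneg show "E n \<le> E (n + 1)"
      using mult_nonneg_nonneg[OF t[of n] nonneg] by (simp only: distrib_right mult_1_left)
  qed
  have "K \<le> E N"
    using \<open>0 \<le> K\<close> t by (simp add: E_def sum_nonneg mult_le_cancel_left1)
  then have start: "v N \<le> E N" "v (N + 1) \<le> E N"
    using \<open>v N \<le> K\<close> \<open>v (N + 1) \<le> K\<close> by auto
  have "v n \<le> E n \<and> v (n + 1) \<le> E n"
    using \<open>n \<ge> N\<close>
  proof (induction n rule: dec_induct)
    case base
    then show ?case using start by simp
  next
    case (step n)
    have "v (n + 2) \<le> t n * v (n + 1) + v n"
      using v step by auto
    also have "\<dots> \<le> t n * E n + E n"
      using step t by (intro add_mono mult_left_mono) auto
    also have "\<dots> \<le> E (n + 1)"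
      using E_step(2)[of n] by (simp add: algebra_simps)
    finally show ?case
      using step E_step(1)[of n] by simp
  qed
  moreover have "E n \<le> K * exp (suminf t)"
    using \<open>0 \<le> K\<close> \<open>summable t\<close> t by (auto simp: E_def intro!: mult_left_mono sum_le_suminf)
  ultimately show ?thesis by linarith
qed

lemma continuous_on_cball_bounded_above:
  fixes f :: "complex \<Rightarrow> real"
  assumes "continuous_on (cball 0 R) f"
  shows "\<exists>M. \<forall>z. cmod z \<le> R \<longrightarrow> f z \<le> M"
proof -
  have "bdd_above (f ` cball 0 R)"
    using assms by (intro bounded_imp_bdd_above compact_imp_bounded compact_continuous_image compact_cball)
  then obtain M where "\<forall>y\<in>f ` cball 0 R. y \<le> M"
    unfolding bdd_above_def by blast
  then show ?thesis
    by (intro exI[of _ M]) auto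
qed

section \<open>Growth of the coefficients \<open>b n\<close>\<close>

text \<open>The hypotheses concern the coefficients alone, so the bounds on solutions serve both
  \<open>p\<close> and \<open>q\<close>. The series over n \<ge> 1 is reindexed to start at
  0.\<close>

locale log_regular_recurrence =
  fixes a b :: "nat \<Rightarrow> real"
  assumes b_pos: "b n > 0"
    and summable_coeffs: "summable (\<lambda>n. (1 + \<bar>a (n + 1)\<bar>) / sqrt (b (n + 1) * b n))"
    and log_regular: "\<exists>n0\<ge>1. (\<forall>n\<ge>n0. (b n)\<^sup>2 \<le> b (n - 1) * b (n + 1)) \<or>
                  (\<forall>n\<ge>n0. (b n)\<^sup>2 \<ge> b (n - 1) * b (n + 1))"
begin

text \<open>A bounded tail of \<open>b\<close> would keep the terms of the convergent series above a
  positive constant.\<close>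

lemma b_not_bounded: "\<exists>n\<ge>m. b n > B"
proof (rule ccontr)
  assume "\<not> ?thesis"
  then have B: "b n \<le> B" if "n \<ge> m" for n
    using that by (force simp: not_less)
  have "B > 0"
    using B[of m] b_pos[of m] by simp
  have "1 / B \<le> (1 + \<bar>a (n + 1)\<bar>) / sqrt (b (n + 1) * b n)" if "n \<ge> m" for n
  proof (rule frac_le)
    have "b (n + 1) * b n \<le> B * B"
      using B that b_pos \<open>B > 0\<close> by (intro mult_mono) (auto intro: less_imp_le)
    then show "sqrt (b (n + 1) * b n) \<le> B"
      using \<open>B > 0\<close> by (intro real_le_lsqrt) (auto simp: power2_eq_square)
  qed (use b_pos in auto)
  then have "1 / B \<le> 0"
    by (intro tendsto_lowerbound[OF summable_LIMSEQ_zero[OF summable_coeffs]])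
       (auto simp: eventually_at_top_linorder)
  then show False
    using \<open>B > 0\<close> by simp
qed

text \<open>The ratios \<open>b (n + 1) / b n\<close> are eventually monotone. If they increase, one
  ratio that is at least 1 forces the same for all later ones, and it exists because
  \<open>b\<close> is unbounded. If they decrease, one ratio below 1 would keep all later ones at
  most 1 and make \<open>b\<close> bounded.\<close>

lemma b_eventually_increasing: "\<exists>N. \<forall>n\<ge>N. b n \<le> b (n + 1)"
proof -
  obtain n0 where n0: "(\<forall>n\<ge>n0. (b n)\<^sup>2 \<le> b (n - 1) * b (n + 1)) \<or>
      (\<forall>n\<ge>n0. (b n)\<^sup>2 \<ge> b (n - 1) * b (n + 1))"
    using log_regular by blast
  have antimono: "b n \<le> b m" if "\<And>k. k \<ge> m \<Longrightarrow> b (k + 1) \<le> b k" "n \<ge> m" for m n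
    using that(2) by (induction n rule: dec_induct) (use that(1) in force)+
  from n0 show ?thesis
  proof
    assume convex: "\<forall>n\<ge>n0. (b n)\<^sup>2 \<le> b (n - 1) * b (n + 1)"
    obtain m where m: "m \<ge> n0" "b m \<le> b (m + 1)"
    proof (rule ccontr)
      assume "\<not> thesis"
      then have "b (k + 1) \<le> b k" if "k \<ge> n0" for k
        using that \<open>\<And>m. n0 \<le> m \<Longrightarrow> b m \<le> b (m + 1) \<Longrightarrow> thesis\<close> by force
      then have "b n \<le> b n0" if "n \<ge> n0" for n
        using that antimono by blast
      then show False
        using b_not_bounded[of n0 "b n0"] by force
    qed
    have "b n \<le> b (n + 1)" if "n \<ge> m" for n
      using that
    proof (induction n rule: dec_induct)
      case (step n)
      have "b (n + 1) * b (n + 1) \<le> b n * b (n + 2)"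
        using convex[rule_format, of "n + 1"] step m by (simp add: power2_eq_square)
      also have "\<dots> \<le> b (n + 1) * b (n + 2)"
        using step b_pos[of "n + 2"] by (intro mult_right_mono) auto
      finally show ?case
        using b_pos[of "n + 1"] by simp
    qed (use m in auto)
    then show ?thesis by blast
  next
    assume concave: "\<forall>n\<ge>n0. (b n)\<^sup>2 \<ge> b (n - 1) * b (n + 1)"
    have "b m \<le> b (m + 1)" if "m \<ge> n0" for m
    proof (rule ccontr)
      assume m: "\<not> b m \<le> b (m + 1)"
      have "b (n + 1) \<le> b n" if "n \<ge> m" for n
        using that
      proof (induction n rule: dec_induct)
        case (step n)
        have "b (n + 1) * b (n + 2) \<le> b n * b (n + 2)"
          using step b_pos[of "n + 2"] by (intro mult_right_mono) auto
        also have "\<dots> \<le> b (n + 1) * b (n + 1)"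
          using concave[rule_format, of "n + 1"] step \<open>m \<ge> n0\<close> by (simp add: power2_eq_square)
        finally show ?case
          using b_pos[of "n + 1"] by simp
      qed (use m in auto)
      then have "b n \<le> b m" if "n \<ge> m" for n
        using that antimono by blast
      then show False
        using b_not_bounded[of m "b m"] by force
    qed
    then show ?thesis by blast
  qed
qed

lemma b_eventually_mono: "\<exists>N. \<forall>m\<ge>N. \<forall>n\<ge>m. b m \<le> b n"
proof -
  obtain N where N: "\<And>n. n \<ge> N \<Longrightarrow> b n \<le> b (n + 1)"
    using b_eventually_increasing by blast
  have "b m \<le> b n" if "m \<ge> N" "n \<ge> m" for m n
    using that(2)
  proof (induction n rule: dec_induct)
    case (step k)
    then show ?case
      using N[of k] \<open>m \<ge> N\<close> by simp
  qed simp
  then show ?thesis by blast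
qed

lemma b_at_top: "filterlim b at_top sequentially"
proof -
  obtain N where mono: "\<And>m n. m \<ge> N \<Longrightarrow> n \<ge> m \<Longrightarrow> b m \<le> b n"
    using b_eventually_mono by blast
  show ?thesis
    unfolding filterlim_at_top eventually_at_top_linorder
  proof
    fix B
    obtain m where "m \<ge> N" "b m > B"
      using b_not_bounded by blast
    then show "\<exists>m. \<forall>n\<ge>m. B \<le> b n"
      using mono by (meson less_imp_le order_trans)
  qed
qed

text \<open>The finitely many values before monotonicity sets in are dominated by their sum, which
  \<open>b n\<close> eventually reaches.\<close>

lemma eventually_b_is_max: "\<forall>\<^sub>F n in sequentially. \<forall>k\<le>n. b k \<le> b n"
proof -
  obtain N where mono: "\<And>m n. m \<ge> N \<Longrightarrow> n \<ge> m \<Longrightarrow> b m \<le> b n"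
    using b_eventually_mono by blast
  have "\<forall>\<^sub>F n in sequentially. b n \<ge> (\<Sum>k<N. b k)"
    using b_at_top by (simp add: filterlim_at_top)
  then show ?thesis
  proof eventually_elim
    case (elim n)
    have "b k \<le> (\<Sum>k<N. b k)" if "k < N" for k
      using that b_pos by (intro member_le_sum) (auto intro: less_imp_le)
    with elim mono show ?case
      by (meson not_less order_trans)
  qed
qed

text \<open>Where \<open>b\<close> increases, \<open>sqrt (b (n + 1) * b n) \<le> b (n + 1)\<close>,
  so the given series dominates.\<close>

lemma summable_inverse_b: "summable (\<lambda>n. 1 / b n)"
proof -
  obtain N where N: "\<And>n. n \<ge> N \<Longrightarrow> b n \<le> b (n + 1)"
    using b_eventually_increasing by blast
  have "summable (\<lambda>n. 1 / b (n + 1))"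
  proof (rule summable_comparison_test'[OF summable_coeffs])
    fix n assume "n \<ge> N"
    then have "b (n + 1) * b n \<le> b (n + 1) * b (n + 1)"
      using N b_pos[of "n + 1"] by (intro mult_left_mono) auto
    then have "sqrt (b (n + 1) * b n) \<le> b (n + 1)"
      using b_pos[of "n + 1"] by (intro real_le_lsqrt) (auto simp: power2_eq_square)
    then show "norm (1 / b (n + 1)) \<le> (1 + \<bar>a (n + 1)\<bar>) / sqrt (b (n + 1) * b n)"
      using b_pos[of n] b_pos[of "n + 1"] by (auto intro!: frac_le)
  qed
  then show ?thesis
    by (simp add: summable_Suc_iff[of "\<lambda>n. 1 / b n"])
qed

section \<open>Locally uniform bounds for solutions\<close>

text \<open>Solve the recurrence for its newest term and multiply by
  \<open>sqrt (W (n + 2))\<close>. Then \<open>W1\<close> makes the coefficient of the middle term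
  summable and \<open>W2\<close> makes that of the oldest at most 1, relative to the weights. The
  discrete Gronwall bound applies with constants independent of \<open>z\<close> in the
  disc.\<close>

lemma weighted_solution_bounded:
  assumes rec: "solves_recurrence a b c r"
    and W: "\<And>n. W n > 0"
    and W1: "\<And>n. n \<ge> N \<Longrightarrow> W (n + 2) * b (n + 1) \<le> W (n + 1) * b (n + 2)"
    and W2: "\<And>n. n \<ge> N \<Longrightarrow> W (n + 2) * (b (n + 1))\<^sup>2 \<le> W n * (b (n + 2))\<^sup>2"
  shows "\<exists>C. \<forall>n z. cmod z \<le> R \<longrightarrow> W n * (cmod (poly (map_poly of_real (r (n + 1))) z))\<^sup>2 \<le> C"
proof -
  define f where "f n = poly (map_poly complex_of_real (r n))" for n
  define v where "v z n = sqrt (W n) * cmod (f (n + 1) z)" for z n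
  \<comment> \<open>On the disc, |z - a| \<le> max 1 R * (1 + |a|). The indices are those of the
    recurrence at \<open>n + 2\<close>.\<close>
  define T where "T n = max 1 R * ((1 + \<bar>a (n + 1 + 1)\<bar>) / sqrt (b (n + 1 + 1) * b (n + 1)))" for n
  have T: "summable T"
    unfolding T_def
    by (intro summable_mult) (use summable_ignore_initial_segment[OF summable_coeffs, of 1] in simp)
  have T_nonneg: "T n \<ge> 0" for n
    using b_pos by (auto simp: T_def intro!: mult_nonneg_nonneg divide_nonneg_nonneg less_imp_le)
  have "\<exists>B. \<forall>z. cmod z \<le> R \<longrightarrow> v z n \<le> B" for n
  proof -
    have "continuous_on (cball 0 R) (\<lambda>z. v z n)"
      unfolding v_def f_def by (intro continuous_intros)
    then show ?thesis
      by (rule continuous_on_cball_bounded_above)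
  qed
  then obtain B where B: "\<And>n z. cmod z \<le> R \<Longrightarrow> v z n \<le> B n"
    by metis
  define K where "K = (\<Sum>k\<le>N + 1. \<bar>B k\<bar>)"
  have K: "v z n \<le> K" if "cmod z \<le> R" "n \<le> N + 1" for z n
  proof -
    have "\<bar>B n\<bar> \<le> K"
      unfolding K_def using that by (intro member_le_sum) auto
    with B[OF that(1), of n] show ?thesis by simp
  qed
  have K_nonneg: "K \<ge> 0"
    by (simp add: K_def sum_nonneg)
  have step: "v z (n + 2) \<le> T n * v z (n + 1) + v z n" if "cmod z \<le> R" "n \<ge> N" for z n
  proof -
    have b: "b n > 0" "b (n + 1) > 0" "b (n + 2) > 0"
      by (auto intro: b_pos)
    have "z * f (n + 2) z = b (n + 2) * f (n + 3) z + a (n + 2) * f (n + 2) z + b (n + 1) * f (n + 1) z"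
      using solves_recurrence_eval[OF rec, of "n + 2" z] by (simp add: f_def eval_nat_numeral)
    then have "b (n + 2) * f (n + 3) z = (z - a (n + 2)) * f (n + 2) z - b (n + 1) * f (n + 1) z"
      by (simp add: algebra_simps)
    then have "cmod (b (n + 2) * f (n + 3) z)
        \<le> cmod ((z - a (n + 2)) * f (n + 2) z) + cmod (b (n + 1) * f (n + 1) z)"
      by (metis norm_triangle_ineq4)
    also have "\<dots> \<le> (max 1 R * (1 + \<bar>a (n + 2)\<bar>)) * cmod (f (n + 2) z) + b (n + 1) * cmod (f (n + 1) z)"
    proof -
      have "cmod (z - a (n + 2)) \<le> cmod z + \<bar>a (n + 2)\<bar>"
        using norm_triangle_ineq4[of z "complex_of_real (a (n + 2))"] by simp
      also have "\<dots> \<le> max 1 R + max 1 R * \<bar>a (n + 2)\<bar>"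
        using that mult_right_mono[of 1 "max 1 R" "\<bar>a (n + 2)\<bar>"] by (intro add_mono) auto
      also have "\<dots> = max 1 R * (1 + \<bar>a (n + 2)\<bar>)"
        by (simp add: distrib_left)
      finally show ?thesis
        using b unfolding norm_mult by (intro add_mono mult_right_mono) auto
    qed
    finally have "cmod (f (n + 3) z) \<le> (max 1 R * (1 + \<bar>a (n + 2)\<bar>)) / b (n + 2) * cmod (f (n + 2) z)
        + b (n + 1) / b (n + 2) * cmod (f (n + 1) z)"
      using b by (simp add: norm_mult field_simps)
    then have "v z (n + 2) \<le> sqrt (W (n + 2)) * ((max 1 R * (1 + \<bar>a (n + 2)\<bar>)) / b (n + 2) * cmod (f (n + 2) z)
        + b (n + 1) / b (n + 2) * cmod (f (n + 1) z))"
      unfolding v_def using W[of "n + 2"] by (intro mult_left_mono) (auto simp: eval_nat_numeral)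
    also have "\<dots> = (max 1 R * (1 + \<bar>a (n + 2)\<bar>)) * (sqrt (W (n + 2)) / b (n + 2)) * cmod (f (n + 2) z)
        + (sqrt (W (n + 2)) * b (n + 1) / b (n + 2)) * cmod (f (n + 1) z)"
      by (simp add: algebra_simps add_divide_distrib)
    also have "\<dots> \<le> (max 1 R * (1 + \<bar>a (n + 2)\<bar>)) * (sqrt (W (n + 1)) / sqrt (b (n + 2) * b (n + 1)))
        * cmod (f (n + 2) z) + sqrt (W n) * cmod (f (n + 1) z)"
    proof (intro add_mono mult_right_mono mult_left_mono)
      have "sqrt (W (n + 2) * (b (n + 2) * b (n + 1))) \<le> sqrt (W (n + 1) * (b (n + 2))\<^sup>2)"
        using W1[OF that(2)] b by (simp add: power2_eq_square mult_ac)
      then show "sqrt (W (n + 2)) / b (n + 2) \<le> sqrt (W (n + 1)) / sqrt (b (n + 2) * b (n + 1))"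
        using b by (simp add: real_sqrt_mult field_simps)
      have "sqrt (W (n + 2) * (b (n + 1))\<^sup>2) \<le> sqrt (W n * (b (n + 2))\<^sup>2)"
        using W2[OF that(2)] by simp
      then show "sqrt (W (n + 2)) * b (n + 1) / b (n + 2) \<le> sqrt (W n)"
        using b by (simp add: real_sqrt_mult field_simps)
    qed auto
    also have "\<dots> = T n * v z (n + 1) + v z n"
      by (simp add: T_def v_def eval_nat_numeral)
    finally show ?thesis .
  qed
  have "v z n \<le> K * exp (suminf T)" if "cmod z \<le> R" for z n
  proof (cases "n \<ge> N")
    case True
    then show ?thesis
      using three_term_inequality_bounded[of T N "v z" K n] T T_nonneg step[OF that] K[OF that] K_nonneg
      by auto
  next
    case False
    have "K \<le> K * exp (suminf T)"
      using K_nonneg suminf_nonneg[OF T T_nonneg] by (simp add: mult_le_cancel_left1)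
    with K[OF that, of n] False show ?thesis
      by simp
  qed
  then have "(v z n)\<^sup>2 \<le> (K * exp (suminf T))\<^sup>2" if "cmod z \<le> R" for z n
    using that W[of n] by (intro power_mono) (auto simp: v_def)
  moreover have "(v z n)\<^sup>2 = W n * (cmod (f (n + 1) z))\<^sup>2" for z n
    using W[of n] by (simp add: v_def power_mult_distrib less_imp_le)
  ultimately have "W n * (cmod (f (n + 1) z))\<^sup>2 \<le> (K * exp (suminf T))\<^sup>2" if "cmod z \<le> R" for z n
    using that by metis
  then show ?thesis
    by (auto simp: f_def)
qed

text \<open>
  The weight is \<open>b\<^sub>n\<close> in the log-convex and \<open>b\<^sub>n\<^sub>+\<^sub>1\<close> in the log-concave case: these make the
  coefficient of the older term in the three-term inequality at most 1.
\<close>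

lemma solution_bounded:
  assumes rec: "solves_recurrence a b c r"
  obtains C where "\<And>n z. cmod z \<le> R \<Longrightarrow> (cmod (poly (map_poly of_real (r (n + 1))) z))\<^sup>2 \<le> C * (1 / b n)"
proof -
  obtain n0 where n0: "(\<forall>n\<ge>n0. (b n)\<^sup>2 \<le> b (n - 1) * b (n + 1)) \<or>
      (\<forall>n\<ge>n0. (b n)\<^sup>2 \<ge> b (n - 1) * b (n + 1))"
    using log_regular by blast
  \<comment> \<open>The constant \<open>D\<close> converts the weight back into \<open>b n\<close>,
    so that both cases end in the same bound.\<close>
  obtain W C D where W: "\<And>n. b n \<le> D * W n" and "D > 0"
    and C: "\<And>n z. cmod z \<le> R \<Longrightarrow> W n * (cmod (poly (map_poly of_real (r (n + 1))) z))\<^sup>2 \<le> C"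
  proof -
    from n0 show thesis
    proof
      assume convex: "\<forall>n\<ge>n0. (b n)\<^sup>2 \<le> b (n - 1) * b (n + 1)"
      \<comment> \<open>With weight \<open>b\<close> the first weight condition is an equality; the
        second is log-convexity multiplied by \<open>b (n + 2)\<close>.\<close>
      have "b (n + 2) * (b (n + 1))\<^sup>2 \<le> b n * (b (n + 2))\<^sup>2" if "n \<ge> n0" for n
        using mult_left_mono[OF convex[rule_format, of "n + 1"], of "b (n + 2)"] that b_pos[of "n + 2"]
        by (simp add: power2_eq_square mult_ac)
      then have "\<exists>C. \<forall>n z. cmod z \<le> R \<longrightarrow> b n * (cmod (poly (map_poly of_real (r (n + 1))) z))\<^sup>2 \<le> C"
        by (intro weighted_solution_bounded[OF rec, where N = n0] b_pos) (auto simp: mult_ac)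
      then obtain C where
        "\<And>n z. cmod z \<le> R \<Longrightarrow> b n * (cmod (poly (map_poly of_real (r (n + 1))) z))\<^sup>2 \<le> C"
        by blast
      then show thesis
        using that[of 1 b C] by simp
    next
      assume concave: "\<forall>n\<ge>n0. (b n)\<^sup>2 \<ge> b (n - 1) * b (n + 1)"
      \<comment> \<open>For the shifted weight, log-concavity is the first weight condition;
        multiplied by \<open>b (n + 1)\<close> it gives the second.\<close>
      have 1: "b (n + 3) * b (n + 1) \<le> b (n + 2) * b (n + 2)" if "n \<ge> n0" for n
        using concave[rule_format, of "n + 2"] that by (simp add: power2_eq_square mult_ac eval_nat_numeral)
      have 2: "b (n + 3) * (b (n + 1))\<^sup>2 \<le> b (n + 1) * (b (n + 2))\<^sup>2" if "n \<ge> n0" for n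
        using mult_left_mono[OF 1[OF that], of "b (n + 1)"] b_pos[of "n + 1"]
        by (simp add: power2_eq_square mult_ac)
      obtain C where
        C: "\<And>n z. cmod z \<le> R \<Longrightarrow> b (n + 1) * (cmod (poly (map_poly of_real (r (n + 1))) z))\<^sup>2 \<le> C"
        using weighted_solution_bounded[OF rec, where W = "\<lambda>n. b (n + 1)" and N = n0 and R = R] b_pos 1 2
        by (auto simp: eval_nat_numeral)
      obtain N where N: "\<And>n. n \<ge> N \<Longrightarrow> b n \<le> b (n + 1)"
        using b_eventually_increasing by blast
      \<comment> \<open>The ratios \<open>b n / b (n + 1)\<close> are at most 1 from
        \<open>N\<close> on; the sum bounds the earlier ones.\<close>
      define D where "D = 1 + (\<Sum>k<N. b k / b (k + 1))"
      have nonneg: "(\<Sum>k<N. b k / b (k + 1)) \<ge> 0"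
        by (intro sum_nonneg divide_nonneg_nonneg less_imp_le b_pos)
      have ratio: "b n / b (n + 1) \<le> D" for n
      proof (cases "n < N")
        case True
        then have "b n / b (n + 1) \<le> (\<Sum>k<N. b k / b (k + 1))"
          using b_pos by (intro member_le_sum) (auto intro!: divide_nonneg_nonneg less_imp_le)
        then show ?thesis by (simp add: D_def)
      next
        case False
        then have "b n / b (n + 1) \<le> 1"
          using N[of n] b_pos[of "n + 1"] by simp
        with nonneg show ?thesis by (simp add: D_def)
      qed
      have "b n \<le> D * b (n + 1)" for n
        using ratio[of n] b_pos[of "n + 1"] by (simp add: pos_divide_le_eq)
      moreover have "D > 0"
        using nonneg by (simp add: D_def)
      ultimately show thesis
        using that[of D "\<lambda>n. b (n + 1)" C] C by blast
    qed
  qed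
  show thesis
  proof
    fix n z assume "cmod z \<le> R"
    have "b n * (cmod (poly (map_poly of_real (r (n + 1))) z))\<^sup>2
        \<le> D * (W n * (cmod (poly (map_poly of_real (r (n + 1))) z))\<^sup>2)"
      using W[of n] by (simp flip: mult.assoc add: mult_right_mono)
    also have "\<dots> \<le> D * C"
      using C[OF \<open>cmod z \<le> R\<close>] \<open>D > 0\<close> by (intro mult_left_mono) auto
    finally show "(cmod (poly (map_poly of_real (r (n + 1))) z))\<^sup>2 \<le> (D * C) * (1 / b n)"
      using b_pos[of n] by (simp add: field_simps)
  qed
qed

section \<open>Local boundedness of \<open>P\<close>\<close>

text \<open>Infinite sum and supremum are total operators, so \<open>P_fun\<close> and
  \<open>max_modulus\<close> carry information only once convergence and boundedness are known. Both
  come from comparison with the summable sequence \<open>1 / b n\<close>.\<close>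

lemma P_fun_bounds:
  assumes rec: "solves_recurrence a b c p"
  shows "bdd_above (P_fun p ` cball 0 R)"
    and "cmod (poly (map_poly of_real (p n)) z) \<le> P_fun p z"
proof -
  \<comment> \<open>The bound is pointwise with \<open>C\<close> free: it is used with one
    \<open>C\<close> for a whole disc, and again with the disc of radius
    \<open>cmod z\<close>.\<close>
  have summ: "summable (\<lambda>n. (cmod (poly (map_poly of_real (p n)) z))\<^sup>2)
      \<and> P_fun p z \<le> sqrt ((cmod (poly (map_poly of_real (p 0)) z))\<^sup>2 + C * (\<Sum>n. 1 / b n))"
    if C: "\<And>n. (cmod (poly (map_poly of_real (p (n + 1))) z))\<^sup>2 \<le> C * (1 / b n)" for z C
  proof -
    have sum': "summable (\<lambda>n. (cmod (poly (map_poly of_real (p (n + 1))) z))\<^sup>2)"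
      by (rule summable_comparison_test'[OF summable_mult[OF summable_inverse_b, of C], of 0])
         (use C in auto)
    then have sum: "summable (\<lambda>n. (cmod (poly (map_poly of_real (p n)) z))\<^sup>2)"
      using summable_iff_shift[of "\<lambda>n. (cmod (poly (map_poly of_real (p n)) z))\<^sup>2" 1] by simp
    have "(\<Sum>n. (cmod (poly (map_poly of_real (p (n + 1))) z))\<^sup>2) \<le> (\<Sum>n. C * (1 / b n))"
      by (intro suminf_le sum' summable_mult summable_inverse_b C)
    also have "\<dots> = C * (\<Sum>n. 1 / b n)"
      by (rule suminf_mult[OF summable_inverse_b])
    finally show ?thesis
      using sum suminf_split_head[OF sum] by (simp add: P_fun_def)
  qed
  show "bdd_above (P_fun p ` cball 0 R)"
  proof -
    obtain C where C: "\<And>n z. cmod z \<le> R \<Longrightarrow> (cmod (poly (map_poly of_real (p (n + 1))) z))\<^sup>2 \<le> C * (1 / b n)"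
      using solution_bounded[OF rec, of R] by blast
    have "continuous_on (cball 0 R)
        (\<lambda>z. sqrt ((cmod (poly (map_poly of_real (p 0)) z))\<^sup>2 + C * (\<Sum>n. 1 / b n)))"
      by (intro continuous_intros)
    from continuous_on_cball_bounded_above[OF this] obtain M where
      M: "\<And>z. cmod z \<le> R \<Longrightarrow> sqrt ((cmod (poly (map_poly of_real (p 0)) z))\<^sup>2 + C * (\<Sum>n. 1 / b n)) \<le> M"
      by blast
    show ?thesis
    proof (rule bdd_aboveI2)
      fix z :: complex assume "z \<in> cball 0 R"
      then show "P_fun p z \<le> M"
        using summ[of z C] C M[of z] by fastforce
    qed
  qed
  obtain C where "\<And>n w. cmod w \<le> cmod z \<Longrightarrow> (cmod (poly (map_poly of_real (p (n + 1))) w))\<^sup>2 \<le> C * (1 / b n)"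
    using solution_bounded[OF rec, of "cmod z"] by blast
  then have "summable (\<lambda>n. (cmod (poly (map_poly of_real (p n)) z))\<^sup>2)"
    using summ[of z C] by blast
  then have "sum (\<lambda>n. (cmod (poly (map_poly of_real (p n)) z))\<^sup>2) {n}
      \<le> (\<Sum>n. (cmod (poly (map_poly of_real (p n)) z))\<^sup>2)"
    by (rule sum_le_suminf) auto
  then show "cmod (poly (map_poly of_real (p n)) z) \<le> P_fun p z"
    unfolding P_fun_def by (intro real_le_rsqrt) auto
qed

end

section \<open>Order functions and their duals\<close>

text \<open>The last property is monotonicity of \<open>r / \<alpha> r\<close> between
  \<open>r\<close> and \<open>c * r\<close>; it lets constant factors be pulled out of the argument
  of \<alpha>.\<close>

lemma order_functionD:
  assumes "order_function r0 \<alpha>"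
  shows "r > r0 \<Longrightarrow> \<alpha> r > 0" "r0 \<ge> 0"
    and "r0 < r \<Longrightarrow> r \<le> s \<Longrightarrow> \<alpha> r \<le> \<alpha> s"
    and "r0 < r \<Longrightarrow> 1 \<le> c \<Longrightarrow> \<alpha> (c * r) \<le> c * \<alpha> r"
proof -
  show pos: "r > r0 \<Longrightarrow> \<alpha> r > 0" "r0 \<ge> 0" for r
    using assms by (auto simp: order_function_def)
  show "r0 < r \<Longrightarrow> r \<le> s \<Longrightarrow> \<alpha> r \<le> \<alpha> s"
    using assms by (auto simp: order_function_def mono_on_def)
  show "\<alpha> (c * r) \<le> c * \<alpha> r" if "r0 < r" "1 \<le> c"
  proof -
    have r: "r > 0" "c * r \<ge> r"
      using that pos(2) by (auto simp: mult_le_cancel_right1)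
    then have cr: "r0 < c * r"
      using that by linarith
    have "mono_on {r0<..} (\<lambda>r. r / \<alpha> r)"
      using assms by (simp add: order_function_def)
    then have "r / \<alpha> r \<le> c * r / \<alpha> (c * r)"
      using that r by (intro mono_onD[where f = "\<lambda>r. r / \<alpha> r"]) (auto intro: cr)
    moreover have "\<alpha> r > 0" "\<alpha> (c * r) > 0"
      using pos that cr by auto
    ultimately have "r * \<alpha> (c * r) \<le> r * (c * \<alpha> r)"
      by (simp add: field_simps)
    then show ?thesis
      using r by simp
  qed
qed

text \<open>The constant \<open>C\<close> costs only a constant factor: for nonzero
  \<open>u (n + 1)\<close>, \<open>\<alpha> (b n) \<le> D * \<alpha> (b n / D) \<le> D * \<alpha>
  (inverse (u (n + 1)))\<close>. The second condition on \<open>g\<close> absorbs the index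
  shift.\<close>

lemma dual_bigoI_of_inverse_bound:
  assumes \<alpha>: "order_function r0 \<alpha>"
    and b: "filterlim b at_top sequentially"
    and u: "\<And>n. u n \<ge> 0" "\<And>n. u (n + 1) \<le> C * (1 / b n)"
    and g: "(\<lambda>n. 1 / \<alpha> (b n)) \<in> O(g)" "(\<lambda>n. g (n - 1)) \<in> O(g)"
  shows "dual_bigo (dual_fun \<alpha>) u g"
proof -
  note \<alpha>D = order_functionD[OF \<alpha>]
  have "(\<lambda>n. u (n + 1)) \<longlonglongrightarrow> 0"
  proof (rule tendsto_sandwich[OF _ _ tendsto_const])
    show "(\<lambda>n. C * (1 / b n)) \<longlonglongrightarrow> 0"
      using tendsto_mult_left[OF tendsto_inverse_0_at_top[OF b], of C] by (simp add: divide_inverse)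
  qed (use u in auto)
  then have u0: "u \<longlonglongrightarrow> 0"
    by (simp add: filterlim_sequentially_Suc)
  \<comment> \<open>The scaling property of \<alpha> asks for a factor of at least 1.\<close>
  define D where "D = max C 1"
  have "D \<ge> 1" "C \<le> D" by (auto simp: D_def)
  \<comment> \<open>This keeps \<open>b n / D\<close> in the domain of \<alpha>.\<close>
  have "\<forall>\<^sub>F n in sequentially. b n > D * (r0 + 1)"
    using b by (simp add: filterlim_at_top_dense)
  then have "\<forall>\<^sub>F n in sequentially. norm (dual_fun \<alpha> (u (n + 1))) \<le> D * norm (1 / \<alpha> (b n))"
  proof eventually_elim
    case (elim n)
    have large: "b n / D > r0"
      using elim \<open>D \<ge> 1\<close> by (simp add: field_simps)
    have "0 < D * (r0 + 1)"
      using \<open>D \<ge> 1\<close> \<alpha>D(2) by (intro mult_pos_pos) auto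
    then have "b n > 0"
      using elim by linarith
    have "b n / D \<le> b n"
      using \<open>b n > 0\<close> \<open>D \<ge> 1\<close> by (simp add: field_simps)
    then have pos: "\<alpha> (b n / D) > 0" "\<alpha> (b n) > 0"
      using \<alpha>D(1) large by auto
    show ?case
    proof (cases "u (n + 1) = 0")
      case True
      then show ?thesis using \<open>D \<ge> 1\<close> by (simp add: dual_fun_def)
    next
      case False
      then have "u (n + 1) > 0" using u(1)[of "n + 1"] by linarith
      have "u (n + 1) \<le> D * (1 / b n)"
        using u(2)[of n] mult_right_mono[OF \<open>C \<le> D\<close>, of "1 / b n"] \<open>b n > 0\<close> by simp
      then have "b n / D \<le> inverse (u (n + 1))"
        using \<open>u (n + 1) > 0\<close> \<open>b n > 0\<close> \<open>D \<ge> 1\<close> by (simp add: field_simps)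
      then have le: "\<alpha> (b n / D) \<le> \<alpha> (inverse (u (n + 1)))"
        using large by (intro \<alpha>D(3))
      then have "D * \<alpha> (b n / D) \<le> D * \<alpha> (inverse (u (n + 1)))"
        using \<open>D \<ge> 1\<close> by (intro mult_left_mono) auto
      moreover have "\<alpha> (b n) \<le> D * \<alpha> (b n / D)"
        using \<alpha>D(4)[OF large \<open>D \<ge> 1\<close>] \<open>D \<ge> 1\<close> by simp
      ultimately have "\<alpha> (b n) \<le> D * \<alpha> (inverse (u (n + 1)))" "\<alpha> (inverse (u (n + 1))) > 0"
        using pos(1) le by linarith+
      then show ?thesis
        using False pos by (simp add: dual_fun_def field_simps)
    qed
  qed
  then have "(\<lambda>n. dual_fun \<alpha> (u (n + 1))) \<in> O(\<lambda>n. 1 / \<alpha> (b n))"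
    by (rule bigoI)
  then have "(\<lambda>n. dual_fun \<alpha> (u (n + 1))) \<in> O(g)"
    using g(1) by (rule landau_o.big_trans)
  \<comment> \<open>Substituting \<open>n - 1\<close> undoes the shift; subtraction is truncated, so
    \<open>n - 1 + 1\<close> is \<open>n\<close> only from 1 on.\<close>
  then have "(\<lambda>n. dual_fun \<alpha> (u (n - 1 + 1))) \<in> O(\<lambda>n. g (n - 1))"
    by (rule landau_o.big.compose) (rule filterlim_minus_const_nat_at_top)
  then have "(\<lambda>n. dual_fun \<alpha> (u (n - 1 + 1))) \<in> O(g)"
    using g(2) by (rule landau_o.big_trans)
  moreover have ev: "\<forall>\<^sub>F n in sequentially. dual_fun \<alpha> (u (n - 1 + 1)) = dual_fun \<alpha> (u n)"
    using eventually_ge_at_top[of 1] by eventually_elim simp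
  ultimately have "(\<lambda>n. dual_fun \<alpha> (u n)) \<in> O(g)"
    using landau_o.big.in_cong[OF ev, of g] by blast
  with u u0 show ?thesis
    by (simp add: dual_bigo_def)
qed

text \<open>Half of \<epsilon> absorbs the logarithm and leaves the convergent series of
  \<open>n powr (- (1 + \<epsilon> / 2))\<close>.\<close>

lemma dual_in_ell_of_dual_bigo:
  assumes \<alpha>: "order_function r0 \<alpha>" and "\<epsilon> > 0"
    and u: "dual_bigo (dual_fun \<alpha>) u (\<lambda>n. ln (real n) / real n)"
  shows "dual_in_ell (dual_fun \<alpha>) u (1 + \<epsilon>)"
proof -
  have nonneg: "\<And>n. u n \<ge> 0" and lim: "u \<longlonglongrightarrow> 0"
    and bigo: "(\<lambda>n. dual_fun \<alpha> (u n)) \<in> O(\<lambda>n. ln (real n) / real n)"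
    using u by (auto simp: dual_bigo_def)
  obtain c where "c > 0"
    and c: "\<forall>\<^sub>F n in sequentially. norm (dual_fun \<alpha> (u n)) \<le> c * norm (ln (real n) / real n)"
    using bigo by (rule landau_o.bigE)
  have "r0 \<ge> 0"
    using order_functionD(2)[OF \<alpha>] .
  \<comment> \<open>A positive \<open>u n\<close> then lies in the domain of the dual function,
    whose value is thus nonnegative, as monotonicity of \<open>powr\<close> in the base
    requires.\<close>
  have "\<forall>\<^sub>F n in sequentially. u n < 1 / (r0 + 1)"
    by (rule order_tendstoD(2)[OF lim]) (use \<open>r0 \<ge> 0\<close> in auto)
  then have "\<forall>\<^sub>F n in sequentially. norm (dual_fun \<alpha> (u n) powr (1 + \<epsilon>)) \<le> (c * (ln (real n) / real n)) powr (1 + \<epsilon>)"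
    using c eventually_ge_at_top[of 1]
  proof eventually_elim
    case (elim n)
    have "dual_fun \<alpha> (u n) \<ge> 0"
    proof (cases "u n = 0")
      case False
      then have "u n > 0" using nonneg[of n] by linarith
      then have "r0 < inverse (u n)"
        using elim(1) \<open>r0 \<ge> 0\<close> by (simp add: field_simps)
      then show ?thesis
        using order_functionD(1)[OF \<alpha>] by (simp add: dual_fun_def less_imp_le)
    qed (simp add: dual_fun_def)
    then show ?case
      using elim \<open>\<epsilon> > 0\<close> by (auto intro!: powr_mono2)
  qed
  moreover have "summable (\<lambda>n. (c * (ln (real n) / real n)) powr (1 + \<epsilon>))"
  proof (rule summable_comparison_test_bigo)
    show "summable (\<lambda>n. norm (real n powr (- (1 + \<epsilon> / 2))))"
      using \<open>\<epsilon> > 0\<close> by (simp add: summable_real_powr_iff)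
    show "(\<lambda>n. (c * (ln (real n) / real n)) powr (1 + \<epsilon>)) \<in> O(\<lambda>n. real n powr (- (1 + \<epsilon> / 2)))"
      using \<open>c > 0\<close> \<open>\<epsilon> > 0\<close> by real_asymp
  qed
  ultimately have "summable (\<lambda>n. dual_fun \<alpha> (u n) powr (1 + \<epsilon>))"
    by (rule summable_comparison_test_ev)
  then have "summable (\<lambda>n. dual_fun \<alpha> (u (N + n)) powr (1 + \<epsilon>))" for N
    by (subst add.commute) (rule summable_ignore_initial_segment)
  with nonneg lim show ?thesis
    by (simp add: dual_in_ell_def)
qed

section \<open>Lower bounds for \<open>\<alpha> (b n)\<close>\<close>

context log_regular_recurrence
begin

text \<open>The Cauchy estimate is applied to \<open>p n\<close>, which \<open>P\<close> dominates
  and whose leading coefficient is the inverse of the product. The threshold for \<open>r\<close> is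
  independent of \<open>n\<close>, so that \<open>r\<close> may later depend on
  \<open>n\<close>.\<close>

lemma power_le_prod_times_order_bound:
  assumes rec: "solves_recurrence a b 0 p" and deg: "\<And>n. degree (p n) = n" and "p 0 = 1"
    and \<alpha>: "order_function r0 \<alpha>" and ord: "order_bounded_by (P_fun p) \<alpha>"
  obtains K where "K > 0"
    and "\<forall>\<^sub>F r in at_top. \<forall>n. r ^ n \<le> (\<Prod>k<n. b k) * r powr (K * \<alpha> r)"
proof -
  obtain K where K: "\<forall>\<^sub>F r in at_top. max_modulus (P_fun p) r \<le> r powr (K * \<alpha> r)"
    using ord by (auto simp: order_bounded_by_def)
  \<comment> \<open>The order bound may come with a nonpositive constant; for r > 1 with \<alpha>
    positive, enlarging it weakens the bound.\<close>
  have "\<forall>\<^sub>F r in at_top. \<forall>n. r ^ n \<le> (\<Prod>k<n. b k) * r powr (max K 1 * \<alpha> r)"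
    using K eventually_gt_at_top[of "max r0 1"]
  proof eventually_elim
    case r: (elim r)
    show ?case
    proof
      fix n :: nat
      define f where "f = map_poly complex_of_real (p n)"
      define B where "B = max_modulus (P_fun p) r"
      have f: "degree f = n" "coeff f n = of_real (coeff (p n) n)"
        by (simp_all add: f_def deg coeff_map_poly degree_map_poly)
      have P_nonneg: "P_fun p z \<ge> 0" for z
        using P_fun_bounds(2)[OF rec, of 0 z] norm_ge_zero order_trans by blast
      have "cmod (lead_coeff f) * r ^ degree f \<le> B"
      proof (rule lead_coeff_le_of_norm_le_on_sphere)
        fix z assume z: "cmod z = r"
        have "cmod (poly f z) \<le> P_fun p z"
          unfolding f_def by (rule P_fun_bounds(2)[OF rec])
        also have "\<dots> \<le> (SUP z\<in>cball 0 r. P_fun p z)"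
          by (rule cSUP_upper) (use z P_fun_bounds(1)[OF rec] in auto)
        finally show "cmod (poly f z) \<le> B"
          using P_nonneg by (simp add: B_def max_modulus_def)
      qed (use r in auto)
      also have "B \<le> r powr (K * \<alpha> r)"
        using r by (simp add: B_def)
      also have "\<dots> \<le> r powr (max K 1 * \<alpha> r)"
        using r order_functionD(1)[OF \<alpha>, of r] by (intro powr_mono mult_right_mono) auto
      finally have "\<bar>coeff (p n) n\<bar> * r ^ n \<le> r powr (max K 1 * \<alpha> r)"
        by (simp only: f norm_of_real)
      moreover have prod_pos: "(\<Prod>k<n. b k) > 0"
        by (intro prod_pos b_pos)
      moreover have coeff: "coeff (p n) n * (\<Prod>k<n. b k) = 1"
        by (rule solves_recurrence_coeff[OF rec deg \<open>p 0 = 1\<close>])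
      moreover have "coeff (p n) n * r ^ n \<le> \<bar>coeff (p n) n\<bar> * r ^ n"
        using r by (intro mult_right_mono) auto
      ultimately have "(\<Prod>k<n. b k) * (coeff (p n) n * r ^ n) \<le> (\<Prod>k<n. b k) * r powr (max K 1 * \<alpha> r)"
        by (intro mult_left_mono) linarith+
      moreover have "(\<Prod>k<n. b k) * (coeff (p n) n * r ^ n) = coeff (p n) n * (\<Prod>k<n. b k) * r ^ n"
        by (simp only: mult_ac)
      ultimately show "r ^ n \<le> (\<Prod>k<n. b k) * r powr (max K 1 * \<alpha> r)"
        using coeff by simp
    qed
  qed
  then show thesis
    using that[of "max K 1"] by simp
qed

lemma prod_b_le_power: "\<forall>\<^sub>F n in sequentially. (\<Prod>k<n. b k) \<le> b n ^ n"
  using eventually_b_is_max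
proof eventually_elim
  case (elim n)
  then have "(\<Prod>k<n. b k) \<le> (\<Prod>k<n. b n)"
    using b_pos by (intro prod_mono) (auto intro: less_imp_le)
  then show ?case by simp
qed

text \<open>For \<open>r = (b n)\<^sup>2\<close> a factor \<open>b n ^ n\<close> cancels, and
  comparing exponents of \<open>b n\<close> gives
  \<open>n \<le> 2 * K * \<alpha> ((b n)\<^sup>2)\<close>. The growth hypothesis then returns to
  \<open>\<alpha> (b n)\<close>.\<close>

lemma inverse_order_bigo_inverse:
  assumes \<alpha>: "order_function r0 \<alpha>" and "K > 0"
    and K: "\<forall>\<^sub>F r in at_top. \<forall>n. r ^ n \<le> (\<Prod>k<n. b k) * r powr (K * \<alpha> r)"
    and "(\<lambda>r. \<alpha> (r\<^sup>2)) \<in> O[at_top](\<alpha>)"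
  shows "(\<lambda>n. 1 / \<alpha> (b n)) \<in> O(\<lambda>n. 1 / real n)"
proof -
  obtain c where "c > 0" and c: "\<forall>\<^sub>F r in at_top. norm (\<alpha> (r\<^sup>2)) \<le> c * norm (\<alpha> r)"
    using assms(4) by (rule landau_o.bigE)
  have b2: "filterlim (\<lambda>n. (b n)\<^sup>2) at_top sequentially"
    by (intro filterlim_pow_at_top b_at_top) simp
  have "\<forall>\<^sub>F n in sequentially. norm (1 / \<alpha> (b n)) \<le> (2 * K * c) * norm (1 / real n)"
    using prod_b_le_power eventually_compose_filterlim[OF K b2] eventually_compose_filterlim[OF c b_at_top]
      eventually_compose_filterlim[OF eventually_gt_at_top[of "max 1 r0"] b_at_top] eventually_gt_at_top[of 0]
  proof eventually_elim
    case (elim n)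
    have \<alpha>_pos: "\<alpha> (b n) > 0"
      using elim order_functionD(1)[OF \<alpha>] by simp
    have "b n ^ n * b n ^ n = ((b n)\<^sup>2) ^ n"
      by (simp add: power2_eq_square power_mult_distrib)
    also have "\<dots> \<le> (\<Prod>k<n. b k) * ((b n)\<^sup>2) powr (K * \<alpha> ((b n)\<^sup>2))"
      using elim(2) by blast
    also have "\<dots> \<le> b n ^ n * ((b n)\<^sup>2) powr (K * \<alpha> ((b n)\<^sup>2))"
      using elim(1) by (intro mult_right_mono) auto
    finally have "b n ^ n \<le> ((b n)\<^sup>2) powr (K * \<alpha> ((b n)\<^sup>2))"
      using b_pos[of n] by simp
    also have "\<dots> = b n powr (2 * (K * \<alpha> ((b n)\<^sup>2)))"
      using b_pos[of n] by (simp add: powr_powr flip: powr_numeral)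
    finally have "b n powr real n \<le> b n powr (2 * (K * \<alpha> ((b n)\<^sup>2)))"
      using b_pos[of n] by (simp add: powr_realpow)
    then have "real n \<le> 2 * (K * \<alpha> ((b n)\<^sup>2))"
      using elim(4) by simp
    also have "\<dots> \<le> 2 * (K * (c * \<alpha> (b n)))"
      using elim(3) \<alpha>_pos \<open>K > 0\<close> by (intro mult_left_mono) auto
    finally show ?case
      using \<alpha>_pos \<open>n > 0\<close> by (simp add: field_simps)
  qed
  then show ?thesis
    by (rule bigoI)
qed

text \<open>
  If \<open>b\<^sub>n\<close> is at most the power \<open>1 / \<gamma>\<close> of \<open>n\<close>, take \<open>r = e b\<^sub>n\<close> in the order bound; otherwise the
  assumption on \<open>\<alpha>\<close> alone gives \<open>\<alpha> (b\<^sub>n) \<ge> n\<close>.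
\<close>

lemma inverse_order_bigo_ln:
  assumes \<alpha>: "order_function r0 \<alpha>" and "K > 0"
    and K: "\<forall>\<^sub>F r in at_top. \<forall>n. r ^ n \<le> (\<Prod>k<n. b k) * r powr (K * \<alpha> r)"
    and "\<gamma> > 0" and \<gamma>: "\<forall>\<^sub>F r in at_top. r powr \<gamma> \<le> \<alpha> r"
  shows "(\<lambda>n. 1 / \<alpha> (b n)) \<in> O(\<lambda>n. ln (real n) / real n)"
proof -
  define e :: real where "e = exp 1"
  have e: "e \<ge> 1" "ln e = 1" "e > 0"
    by (auto simp: e_def)
  \<comment> \<open>The second entry serves small \<open>b n\<close>, the entry 1 serves large
    \<open>b n\<close>.\<close>
  define C where "C = max 1 (K * e * (1 + 1 / \<gamma>))"
  have eb: "filterlim (\<lambda>n. e * b n) at_top sequentially"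
    by (intro filterlim_tendsto_pos_mult_at_top[OF tendsto_const] b_at_top e)
  \<comment> \<open>This absorbs the summand 1 in \<open>1 + ln (b n)\<close> and yields
    \<open>1 \<le> C * ln (real n)\<close>.\<close>
  have "\<forall>\<^sub>F n in sequentially. ln (real n) > 1"
    by real_asymp
  then have "\<forall>\<^sub>F n in sequentially. norm (1 / \<alpha> (b n)) \<le> C * norm (ln (real n) / real n)"
    using prod_b_le_power eventually_compose_filterlim[OF K eb] eventually_compose_filterlim[OF \<gamma> b_at_top]
      eventually_compose_filterlim[OF eventually_gt_at_top[of "max 1 r0"] b_at_top] eventually_gt_at_top[of 0]
  proof eventually_elim
    case (elim n)
    have \<alpha>_pos: "\<alpha> (b n) > 0"
      using elim order_functionD(1)[OF \<alpha>] by simp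
    have "b n \<le> e * b n"
      using e b_pos[of n] by (simp add: mult_le_cancel_right1)
    moreover have "r0 < b n"
      using elim(5) by simp
    ultimately have \<alpha>_pos': "\<alpha> (e * b n) > 0"
      by (intro order_functionD(1)[OF \<alpha>]) linarith
    have "real n \<le> \<alpha> (b n) * (C * ln (real n))"
    proof (cases "b n \<le> real n powr (1 / \<gamma>)")
      case True
      \<comment> \<open>After cancelling \<open>b n ^ n\<close>, logarithms leave \<open>n\<close>
        on the left. On the right, \<open>ln (b n)\<close> is at most
        \<open>ln n / \<gamma>\<close>, and the factor \<open>e\<close> is pulled out of
        \<alpha>.\<close>
      have "e ^ n * b n ^ n = (e * b n) ^ n"
        by (simp add: power_mult_distrib)
      also have "\<dots> \<le> (\<Prod>k<n. b k) * (e * b n) powr (K * \<alpha> (e * b n))"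
        using elim(3) by blast
      also have "\<dots> \<le> b n ^ n * (e * b n) powr (K * \<alpha> (e * b n))"
        using elim(2) by (intro mult_right_mono) auto
      finally have "e ^ n \<le> (e * b n) powr (K * \<alpha> (e * b n))"
        using b_pos[of n] by (simp add: mult.commute)
      then have "ln (e ^ n) \<le> ln ((e * b n) powr (K * \<alpha> (e * b n)))"
        using e b_pos[of n] by (subst ln_le_cancel_iff) auto
      then have "real n \<le> K * \<alpha> (e * b n) * (1 + ln (b n))"
        using e b_pos[of n] by (simp add: ln_realpow ln_powr ln_mult)
      also have "\<dots> \<le> K * (e * \<alpha> (b n)) * ((1 + 1 / \<gamma>) * ln (real n))"
      proof (intro mult_mono mult_left_mono)
        show "\<alpha> (e * b n) \<le> e * \<alpha> (b n)"
          using elim(5) e by (intro order_functionD(4)[OF \<alpha>]) auto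
        have "ln (b n) \<le> ln (real n powr (1 / \<gamma>))"
          using True b_pos[of n] elim(6) by (subst ln_le_cancel_iff) auto
        then show "1 + ln (b n) \<le> (1 + 1 / \<gamma>) * ln (real n)"
          using elim(1) elim(6) by (simp add: ln_powr algebra_simps)
      qed (use \<open>K > 0\<close> e \<alpha>_pos \<alpha>_pos' elim in auto)
      also have "\<dots> = \<alpha> (b n) * ((K * e * (1 + 1 / \<gamma>)) * ln (real n))"
        by (simp add: mult_ac)
      also have "\<dots> \<le> \<alpha> (b n) * (C * ln (real n))"
        using \<alpha>_pos elim(1) by (intro mult_left_mono mult_right_mono) (auto simp: C_def)
      finally show ?thesis .
    next
      case False
      have "real n = (real n powr (1 / \<gamma>)) powr \<gamma>"
        using \<open>\<gamma> > 0\<close> elim(6) by (simp add: powr_powr)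
      also have "\<dots> \<le> b n powr \<gamma>"
        using False \<open>\<gamma> > 0\<close> by (intro powr_mono2) auto
      also have "\<dots> \<le> \<alpha> (b n) * 1"
        using elim(4) by simp
      also have "\<dots> \<le> \<alpha> (b n) * (C * ln (real n))"
      proof (intro mult_left_mono)
        show "1 \<le> C * ln (real n)"
          using mult_mono[of 1 C 1 "ln (real n)"] elim(1) by (simp add: C_def)
      qed (use \<alpha>_pos in auto)
      finally show ?thesis .
    qed
    then show ?case
      using \<alpha>_pos \<open>n > 0\<close> elim(1) by (simp add: field_simps)
  qed
  then show ?thesis
    by (rule bigoI)
qed

end

section \<open>Decay of the three sequences under the dual function\<close>

theorem theorem5p9:
  fixes \<mu> :: "real measure" and p q :: "nat \<Rightarrow> real poly" and a b :: "nat \<Rightarrow> real"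
    and r0 :: real and \<alpha> \<beta> :: "real \<Rightarrow> real"
  assumes "hamburger_data \<mu> p q a b"
    and "summable (\<lambda>n. (1 + \<bar>a (n + 1)\<bar>) / sqrt (b (n + 1) * b n))"
    and "\<exists>n0\<ge>1. (\<forall>n\<ge>n0. (b n)\<^sup>2 \<le> b (n - 1) * b (n + 1)) \<or>
                  (\<forall>n\<ge>n0. (b n)\<^sup>2 \<ge> b (n - 1) * b (n + 1))"
    and "order_function r0 \<alpha>"
    and "\<beta> = dual_fun \<alpha>"
    and "order_bounded_by (P_fun p) \<alpha>"
  shows "((\<exists>\<gamma>. 0 < \<gamma> \<and> \<gamma> < 1 \<and> (\<forall>\<^sub>F r in at_top. r powr \<gamma> \<le> \<alpha> r)) \<longrightarrow>
           dual_bigo \<beta> (\<lambda>n. 1 / b n) (\<lambda>n. ln (real n) / real n) \<and>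
           dual_bigo \<beta> (\<lambda>n. (poly (p n) 0)\<^sup>2) (\<lambda>n. ln (real n) / real n) \<and>
           dual_bigo \<beta> (\<lambda>n. (poly (q n) 0)\<^sup>2) (\<lambda>n. ln (real n) / real n)) \<and>
         ((\<lambda>r. \<alpha> (r\<^sup>2)) \<in> O[at_top](\<alpha>) \<longrightarrow>
           dual_bigo \<beta> (\<lambda>n. 1 / b n) (\<lambda>n. 1 / real n) \<and>
           dual_bigo \<beta> (\<lambda>n. (poly (p n) 0)\<^sup>2) (\<lambda>n. 1 / real n) \<and>
           dual_bigo \<beta> (\<lambda>n. (poly (q n) 0)\<^sup>2) (\<lambda>n. 1 / real n)) \<and>
         ((\<exists>\<gamma>. 0 < \<gamma> \<and> \<gamma> < 1 \<and> (\<forall>\<^sub>F r in at_top. r powr \<gamma> \<le> \<alpha> r)) \<or>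
          (\<lambda>r. \<alpha> (r\<^sup>2)) \<in> O[at_top](\<alpha>) \<longrightarrow>
           (\<forall>\<epsilon>>0. dual_in_ell \<beta> (\<lambda>n. 1 / b n) (1 + \<epsilon>) \<and>
                  dual_in_ell \<beta> (\<lambda>n. (poly (p n) 0)\<^sup>2) (1 + \<epsilon>) \<and>
                  dual_in_ell \<beta> (\<lambda>n. (poly (q n) 0)\<^sup>2) (1 + \<epsilon>)))"
proof -
  have p: "solves_recurrence a b 0 p" "\<And>n. degree (p n) = n" "p 0 = 1"
    and q: "solves_recurrence a b (- 1) q" and b_pos: "\<And>n. b n > 0"
    using assms(1) by (auto simp: hamburger_data_def orthonormal_polys_def)
  interpret log_regular_recurrence a b
    using b_pos assms(2,3) by unfold_locales auto
  obtain K where K: "K > 0" "\<forall>\<^sub>F r in at_top. \<forall>n. r ^ n \<le> (\<Prod>k<n. b k) * r powr (K * \<alpha> r)"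
    using power_le_prod_times_order_bound[OF p assms(4,6)] by blast
  \<comment> \<open>The free initial value \<open>c\<close> covers \<open>p\<close> and
    \<open>q\<close> at once; for values at 0 the disc of radius 0 suffices.\<close>
  have eval_at_0: "dual_bigo \<beta> (\<lambda>n. (poly (r n) 0)\<^sup>2) g"
    if rec: "solves_recurrence a b c r"
      and g: "(\<lambda>n. 1 / \<alpha> (b n)) \<in> O(g)" "(\<lambda>n. g (n - 1)) \<in> O(g)" for c r g
  proof -
    obtain C where C: "\<And>n z. cmod z \<le> 0 \<Longrightarrow> (cmod (poly (map_poly of_real (r (n + 1))) z))\<^sup>2 \<le> C * (1 / b n)"
      using solution_bounded[OF rec, where R = 0] by blast
    have "(poly (r (n + 1)) 0)\<^sup>2 \<le> C * (1 / b n)" for n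
      using C[of 0 n] by (simp add: poly_map_poly_of_real_simps(4))
    then show ?thesis
      unfolding \<open>\<beta> = dual_fun \<alpha>\<close>
      by (intro dual_bigoI_of_inverse_bound[OF assms(4) b_at_top _ _ g]) auto
  qed
  \<comment> \<open>Here \<open>\<beta> (1 / b n)\<close> is exactly
    \<open>1 / \<alpha> (b n)\<close>, with no index shift.\<close>
  have inverse_b: "dual_bigo \<beta> (\<lambda>n. 1 / b n) g" if "(\<lambda>n. 1 / \<alpha> (b n)) \<in> O(g)" for g
    using that b_pos tendsto_inverse_0_at_top[OF b_at_top]
    by (auto simp: dual_bigo_def \<open>\<beta> = dual_fun \<alpha>\<close> dual_fun_def divide_inverse less_imp_le less_imp_neq[THEN not_sym])
  have shift: "(\<lambda>n. ln (real (n - 1)) / real (n - 1)) \<in> O(\<lambda>n. ln (real n) / real n)"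
    "(\<lambda>n. 1 / real (n - 1)) \<in> O(\<lambda>n. 1 / real n)"
    by real_asymp+
  have ln: "(\<lambda>n. 1 / \<alpha> (b n)) \<in> O(\<lambda>n. ln (real n) / real n)"
    if "\<exists>\<gamma>. 0 < \<gamma> \<and> \<gamma> < 1 \<and> (\<forall>\<^sub>F r in at_top. r powr \<gamma> \<le> \<alpha> r)"
    using that inverse_order_bigo_ln[OF assms(4) K] by blast
  have inv: "(\<lambda>n. 1 / \<alpha> (b n)) \<in> O(\<lambda>n. 1 / real n)" if "(\<lambda>r. \<alpha> (r\<^sup>2)) \<in> O[at_top](\<alpha>)"
    using that by (rule inverse_order_bigo_inverse[OF assms(4) K])
  \<comment> \<open>The sharper bound also implies the logarithmic one, from which the summability
    claim follows in both cases.\<close>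
  have "(\<lambda>n. 1 / real n) \<in> O(\<lambda>n. ln (real n) / real n)"
    by real_asymp
  then have ln': "(\<lambda>n. 1 / \<alpha> (b n)) \<in> O(\<lambda>n. ln (real n) / real n)"
    if "(\<lambda>r. \<alpha> (r\<^sup>2)) \<in> O[at_top](\<alpha>)"
    using inv[OF that] landau_o.big_trans by blast
  note bigos = inverse_b eval_at_0[OF p(1)] eval_at_0[OF q]
  have ell: "dual_in_ell \<beta> u (1 + \<epsilon>)"
    if "dual_bigo \<beta> u (\<lambda>n. ln (real n) / real n)" "\<epsilon> > 0" for u \<epsilon>
    using dual_in_ell_of_dual_bigo[OF assms(4)] that \<open>\<beta> = dual_fun \<alpha>\<close> by blast
  show ?thesis
    using bigos shift ln ln' inv by (intro conjI impI allI ell) blast+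
qed

end
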